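(* Let $q\in\mathbb{N}$, let $G=([q],E)$ be a tournament graph, and let $F_0\in\mathbf{F}_L$ be a known link function, so that the family of admissible link functions is the singleton $\mathcal{F}=\{F_0\}$ and the data are generated by $F_0$ and some merit vector $\boldsymbol{\theta}_0\in\mathbb{R}^q$. Then the ranking is point identified with respect to $G$ and $\{F_0\}$ if and only if $G$ is connected (i.e. for any pair of teams there is a path in $G$ connecting them).
   Context: **Teams, merits, ranking.** $[q]=\{1,\dots,q\}$ is a set of teams. A merit vector is $\boldsymbol{\theta}\in\mathbb{R}^q$ (smaller $\theta_\ell$ means higher merit; ties allowed). The rank of team $\ell$ is $r_\ell(\boldsymbol{\theta})=1+\sum_{i\in[q]}I\{\theta_\ell>\theta_i\}$ and the ranking is the vector $\boldsymbol{r}(\boldsymbol{\theta})=(r_\ell(\boldsymbol{\theta}))_{\ell\in[q]}$. **Tournament graph.** $G=([q],E)$ is a simple undirected graph; $E$ is the set of unordered pairs of distinct teams that interact. **Outcomes.** For an interacting pair, $Y_{\ell,k}\in\{0,1\}$ indicates a win of $\ell$ over $k$, with $Y_{k,\ell}=1-Y_{\ell,k}$. Given a link function $F$ and merits $\boldsymbol{\theta}$, $\mathbb{P}_{F,\boldsymbol{\theta}}(Y_{\ell,k}=1)=F(\theta_\ell,\theta_k)$. Outcomes are mutually independent across pairs and repetitions, and identically distributed across repetitions of the same pair, so the distribution $P$ of the observed data is described by the numbers $P(Y_{\ell,k}=1)$, $(\ell,k)\in E$. **Family $\mathbf{F}_L$.** The set of functions $F:\mathbb{R}\times\mathbb{R}\to(0,1)$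 for which there exists $f:\mathbb{R}\to(0,1)$ such that (1) $F(x,y)=f(y-x)$ for all $(x,y)\in\mathbb{R}^2$; (2) $f(x)=1-f(-x)$ for all $x\in\mathbb{R}$; (3) $f$ is strictly increasing and continuous. **Identification.** For a family $\mathcal{F}$ of link functions: - permissible distributions: $\mathbf{P}(G,\mathcal{F})=\{(\mathbb{P}_{F,\boldsymbol{\theta}}(Y_{\ell,k}=1))_{(\ell,k)\in E}:\boldsymbol{\theta}\in\mathbb{R}^q,\ F\in\mathcal{F}\}$; - observationally equivalent merits: $\Theta(G,\mathcal{F},P)=\{\boldsymbol{\theta}\in\mathbb{R}^q:\exists F\in\mathcal{F},\ \mathbb{P}_{F,\boldsymbol{\theta}}(Y_{\ell,k}=1)=P(Y_{\ell,k}=1)\ \forall(\ell,k)\in E\}$; - identified set: $R(G,\mathcal{F},P)=\{\boldsymbol{r}(\boldsymbol{\theta}):\boldsymbol{\theta}\in\Theta(G,\mathcal{F},P)\}$. The ranking is *point identified* with respect to $G$ and $\mathcal{F}$ if $R(G,\mathcal{F},P)$ is a singleton for every $P\in\mathbf{P}(G,\mathcal{F})$. *)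

theory Defs
  imports Complex_Main "HOL-Library.FuncSet" "Graph_Theory.Graph_Theory"
begin

type_synonym link = "real \<Rightarrow> real \<Rightarrow> real"

text \<open>
  A simple undirected graph is a \<open>pair_graph\<close>: a finite, loop-free digraph without parallel
  arcs whose arc relation is symmetric. The unordered pair of \<open>l\<close> and \<open>k\<close> is present iff
  both \<open>(l, k)\<close> and \<open>(k, l)\<close> are arcs.
\<close>

definition tournament_graph :: "nat \<Rightarrow> nat pair_pre_digraph \<Rightarrow> bool" where
  "tournament_graph q G \<longleftrightarrow> pair_graph G \<and> pverts G = {1..q}"

text \<open>
  The library's \<open>connected\<close> additionally requires a nonempty vertex set; the following notion
  does not, so that it also makes sense for the graph without teams. For a nonempty vertex
  set the two agree.
\<close>

definition graph_connected :: "'a pair_pre_digraph \<Rightarrow> bool" where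
  "graph_connected G \<longleftrightarrow>
    (\<forall>u\<in>pverts G. \<forall>v\<in>pverts G. \<exists>p. pre_digraph.apath (with_proj G) u p v)"

lemma graph_connected_iff_connected:
  assumes "pair_graph G" and "pverts G \<noteq> {}"
  shows "graph_connected G \<longleftrightarrow> Digraph_Component.connected (with_proj G)"
proof -
  interpret pair_graph G by fact
  have "symmetric (with_proj G)" by (rule pair_sym_arcs)
  then show ?thesis
    using assms(2)
    by (simp add: graph_connected_def Digraph_Component.connected_def strongly_connected_def
        reachable_mk_symmetric_eq reachable_apath)
qed

text \<open>
  Merit vectors, and rankings likewise, are extensional functions on the teams, so that two of
  them are equal iff they have the same components.
\<close>

definition merits :: "nat \<Rightarrow> (nat \<Rightarrow> real) set" where
  "merits q = ({1..q} \<rightarrow>\<^sub>E UNIV)"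

definition ranking :: "nat \<Rightarrow> (nat \<Rightarrow> real) \<Rightarrow> nat \<Rightarrow> nat" where
  "ranking q \<theta> = (\<lambda>l\<in>{1..q}. 1 + (\<Sum>i\<in>{1..q}. of_bool (\<theta> l > \<theta> i)))"

definition F_L :: "link set" where
  "F_L = {F. (\<forall>x y. F x y \<in> {0<..<1}) \<and>
    (\<exists>f :: real \<Rightarrow> real. range f \<subseteq> {0<..<1} \<and>
      (\<forall>x y. F x y = f (y - x)) \<and>
      (\<forall>x. f x = 1 - f (- x)) \<and>
      strict_mono f \<and> continuous_on UNIV f)}"

text \<open>
  The probability that the first team of the pair beats the second. A distribution of the data
  is the extensional family of these numbers, indexed by the arcs.
\<close>

definition win_prob :: "link \<Rightarrow> (nat \<Rightarrow> real) \<Rightarrow> nat \<times> nat \<Rightarrow> real" where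
  "win_prob F \<theta> = (\<lambda>(l, k). F (\<theta> l) (\<theta> k))"

definition permissible ::
    "nat \<Rightarrow> nat pair_pre_digraph \<Rightarrow> link set \<Rightarrow> (nat \<times> nat \<Rightarrow> real) set" where
  "permissible q G \<F> =
    {restrict (win_prob F \<theta>) (parcs G) | \<theta> F. \<theta> \<in> merits q \<and> F \<in> \<F>}"

definition obs_equiv_merits ::
    "nat \<Rightarrow> nat pair_pre_digraph \<Rightarrow> link set \<Rightarrow> (nat \<times> nat \<Rightarrow> real) \<Rightarrow> (nat \<Rightarrow> real) set" where
  "obs_equiv_merits q G \<F> P =
    {\<theta> \<in> merits q. \<exists>F\<in>\<F>. \<forall>e\<in>parcs G. win_prob F \<theta> e = P e}"

definition identified_set ::
    "nat \<Rightarrow> nat pair_pre_digraph \<Rightarrow> link set \<Rightarrow> (nat \<times> nat \<Rightarrow> real) \<Rightarrow> (nat \<Rightarrow> nat) set" where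
  "identified_set q G \<F> P = ranking q ` obs_equiv_merits q G \<F> P"

definition point_identified :: "nat \<Rightarrow> nat pair_pre_digraph \<Rightarrow> link set \<Rightarrow> bool" where
  "point_identified q G \<F> \<longleftrightarrow>
    (\<forall>P\<in>permissible q G \<F>. is_singleton (identified_set q G \<F> P))"

end

theory Submission
  imports Defs
begin

text \<open>
  As \<open>F\<^sub>0 x y = f (y - x)\<close> with \<open>f\<close> injective, the data determine exactly the merit differences
  along arcs. On a connected graph these add up along paths to all merit differences, hence to
  the ranking. Otherwise, raising the merits of one connected component by a constant leaves the
  data unchanged but breaks a tie.
\<close>

text \<open>A strictly increasing \<open>f\<close> is injective, so its value at a merit difference
  determines that difference.\<close>

lemma F_L_eq_iff:
  assumes "F \<in> F_L"
  shows "F a b = F c d \<longleftrightarrow> b - a = d - c"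
proof -
  obtain f :: "real \<Rightarrow> real" where "\<And>x y. F x y = f (y - x)" and "strict_mono f"
    using assms unfolding F_L_def by auto
  then show ?thesis
    by (simp add: strict_mono_eq)
qed

text \<open>Each comparison inside a rank depends only on the sign of a merit difference, so a shift
  common to all teams is invisible.\<close>

lemma ranking_cong_diff:
  assumes "\<And>u v. \<lbrakk>u \<in> {1..q}; v \<in> {1..q}\<rbrakk> \<Longrightarrow> \<theta> u - \<theta> v = \<theta>' u - \<theta>' v"
  shows "ranking q \<theta> = ranking q \<theta>'"
  unfolding ranking_def
proof (rule restrict_ext, rule arg_cong[where f = "(+) 1"], rule sum.cong[OF refl])
  fix l i assume "l \<in> {1..q}" "i \<in> {1..q}"
  with assms[of l i] have "\<theta> l > \<theta> i \<longleftrightarrow> \<theta>' l > \<theta>' i"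
    by linarith
  then show "(of_bool (\<theta> l > \<theta> i) :: nat) = of_bool (\<theta>' l > \<theta>' i)"
    by simp
qed

lemma ranking_const:
  assumes "l \<in> {1..q}" and "\<And>i. i \<in> {1..q} \<Longrightarrow> \<theta> i = c"
  shows "ranking q \<theta> l = 1"
  using assms by (simp add: ranking_def)

lemma ranking_gt_1:
  assumes "l \<in> {1..q}" "i \<in> {1..q}" "\<theta> i < \<theta> l"
  shows "ranking q \<theta> l > 1"
proof -
  \<comment> \<open>The summand at \<open>i\<close> is 1, and a sum of naturals vanishes only if all
    its summands do.\<close>
  have "(\<Sum>i\<in>{1..q}. of_bool (\<theta> l > \<theta> i) :: nat) \<noteq> 0"
    using assms by auto
  then show ?thesis
    using assms(1) by (simp add: ranking_def card_gt_0_iff)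
qed

text \<open>With a single admissible link, the same \<open>F\<close> produces both families of
  probabilities and can be cancelled arc by arc. Both directions of the theorem work with the
  resulting linear equations.\<close>

lemma obs_equiv_merits_iff_diff:
  assumes "F \<in> F_L"
  shows "\<theta>' \<in> obs_equiv_merits q G {F} (restrict (win_prob F \<theta>) (parcs G)) \<longleftrightarrow>
    \<theta>' \<in> merits q \<and> (\<forall>(l, k)\<in>parcs G. \<theta>' k - \<theta>' l = \<theta> k - \<theta> l)"
  unfolding obs_equiv_merits_def win_prob_def by (auto simp: F_L_eq_iff[OF assms])

lemma (in pair_graph) graph_connected_iff_reachable:
  "graph_connected G \<longleftrightarrow> (\<forall>u\<in>pverts G. \<forall>v\<in>pverts G. u \<rightarrow>\<^sup>*\<^bsub>with_proj G\<^esub> v)"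
  by (simp add: graph_connected_def reachable_apath)

text \<open>Induction along a walk; it spreads a quantity preserved by every arc over everything
  reachable.\<close>

lemma (in wf_digraph) reachable_eqI:
  assumes "u \<rightarrow>\<^sup>*\<^bsub>G\<^esub> v" and "\<And>x y. x \<rightarrow>\<^bsub>G\<^esub> y \<Longrightarrow> g x = g y"
  shows "g u = g v"
  using assms(1) by (induction rule: reachable_induct) (auto dest: assms(2))

lemma point_identified_if_connected:
  assumes "F \<in> F_L" and "tournament_graph q G" and "graph_connected G"
  shows "point_identified q G {F}"
  unfolding point_identified_def
proof
  interpret pair_graph G
    using assms(2) by (simp add: tournament_graph_def)
  have verts: "pverts G = {1..q}"
    using assms(2) by (simp add: tournament_graph_def)
  fix P assume "P \<in> permissible q G {F}"
  then obtain \<theta> where \<theta>: "\<theta> \<in> merits q" and P: "P = restrict (win_prob F \<theta>) (parcs G)"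
    unfolding permissible_def by auto
  have "ranking q \<theta>' = ranking q \<theta>" if "\<theta>' \<in> obs_equiv_merits q G {F} P" for \<theta>'
  proof (rule ranking_cong_diff)
    fix u v assume "u \<in> {1..q}" "v \<in> {1..q}"
    then have "u \<rightarrow>\<^sup>*\<^bsub>with_proj G\<^esub> v"
      using verts assms(3) by (simp add: graph_connected_iff_reachable)
    then have "\<theta>' u - \<theta> u = \<theta>' v - \<theta> v"
    \<comment> \<open>Equal differences along an arc mean that \<open>\<theta>' - \<theta>\<close>
      takes the same value at both ends.\<close>
    proof (rule reachable_eqI[where g = "\<lambda>w. \<theta>' w - \<theta> w"])
      fix x y assume "(x, y) \<in> parcs G"
      then have "\<theta>' y - \<theta>' x = \<theta> y - \<theta> x"
        using that unfolding P obs_equiv_merits_iff_diff[OF assms(1)] by blast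
      then show "\<theta>' x - \<theta> x = \<theta>' y - \<theta> y"
        by linarith
    qed
    then show "\<theta>' u - \<theta>' v = \<theta> u - \<theta> v"
      by linarith
  qed
  \<comment> \<open>The generating vector itself shows that the identified set is nonempty.\<close>
  moreover have "\<theta> \<in> obs_equiv_merits q G {F} P"
    unfolding P obs_equiv_merits_iff_diff[OF assms(1)] using \<theta> by auto
  ultimately have "identified_set q G {F} P = {ranking q \<theta>}"
    unfolding identified_set_def by (intro equalityI subsetI) (blast, blast)
  then show "is_singleton (identified_set q G {F} P)"
    by simp
qed

lemma connected_if_point_identified:
  assumes "F \<in> F_L" and "tournament_graph q G" and "point_identified q G {F}"
  shows "graph_connected G"
proof (rule ccontr)
  interpret pair_graph G
    using assms(2) by (simp add: tournament_graph_def)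
  have verts: "pverts G = {1..q}"
    using assms(2) by (simp add: tournament_graph_def)
  assume "\<not> graph_connected G"
  then obtain u v where u: "u \<in> {1..q}" and v: "v \<in> {1..q}"
    and not_reach: "\<not> u \<rightarrow>\<^sup>*\<^bsub>with_proj G\<^esub> v"
    using verts by (auto simp: graph_connected_iff_reachable)
  \<comment> \<open>All teams are tied under \<open>\<theta>\<close>; \<open>\<theta>'\<close> is
    the indicator of the component of \<open>u\<close>, which lowers the rank of \<open>u\<close>
    below that of \<open>v\<close>.\<close>
  define \<theta> :: "nat \<Rightarrow> real" where "\<theta> = (\<lambda>l\<in>{1..q}. 0)"
  define \<theta>' :: "nat \<Rightarrow> real" where
    "\<theta>' = (\<lambda>l\<in>{1..q}. of_bool (u \<rightarrow>\<^sup>*\<^bsub>with_proj G\<^esub> l))"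
  define P where "P = restrict (win_prob F \<theta>) (parcs G)"
  have merits: "\<theta> \<in> merits q" "\<theta>' \<in> merits q"
    by (auto simp: \<theta>_def \<theta>'_def merits_def)
  have "\<theta>' k - \<theta>' l = \<theta> k - \<theta> l" if "(l, k) \<in> parcs G" for l k
  proof -
    have "l \<in> {1..q}" "k \<in> {1..q}"
      using that verts wellformed by auto
    \<comment> \<open>By symmetry no arc enters or leaves the component of \<open>u\<close>, so
      \<open>\<theta>'\<close> agrees at both ends of each arc.\<close>
    moreover have "(k, l) \<in> parcs G"
      using that by (rule arcs_symmetric)
    then have "u \<rightarrow>\<^sup>*\<^bsub>with_proj G\<^esub> l \<longleftrightarrow> u \<rightarrow>\<^sup>*\<^bsub>with_proj G\<^esub> k"
      using reachable_adj_trans[of u l k] reachable_adj_trans[of u k l] that by iprover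
    ultimately show ?thesis
      by (simp add: \<theta>_def \<theta>'_def)
  qed
  then have "\<theta> \<in> obs_equiv_merits q G {F} P" "\<theta>' \<in> obs_equiv_merits q G {F} P"
    unfolding P_def obs_equiv_merits_iff_diff[OF assms(1)] using merits by auto
  then have "ranking q \<theta> \<in> identified_set q G {F} P" "ranking q \<theta>' \<in> identified_set q G {F} P"
    unfolding identified_set_def by simp_all
  moreover have "is_singleton (identified_set q G {F} P)"
    using assms(3) merits(1) by (auto simp: point_identified_def permissible_def P_def)
  then obtain r where "identified_set q G {F} P = {r}"
    by (rule is_singletonE)
  ultimately have "ranking q \<theta>' = ranking q \<theta>"
    by simp
  moreover have "ranking q \<theta> u = 1"
    by (rule ranking_const[OF u, where c = 0]) (simp add: \<theta>_def)
  \<comment> \<open>As a vertex, \<open>u\<close> reaches itself, so \<open>\<theta>' u = 1\<close>,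
    while \<open>\<theta>' v = 0\<close>.\<close>
  moreover have "\<theta>' v < \<theta>' u"
    using u v not_reach verts by (simp add: \<theta>'_def)
  then have "ranking q \<theta>' u > 1"
    by (rule ranking_gt_1[OF u v])
  ultimately show False
    by simp
qed

theorem theorem1:
  fixes q :: nat and G :: "nat pair_pre_digraph" and F\<^sub>0 :: link
  assumes "tournament_graph q G" and "F\<^sub>0 \<in> F_L"
  shows "point_identified q G {F\<^sub>0} \<longleftrightarrow> graph_connected G"
  using connected_if_point_identified[OF assms(2,1)] point_identified_if_connected[OF assms(2,1)] ..

end
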